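(* If $S$ is an aic of a commutative unital ring $R$ and $\mathfrak{q}\in\mathrm{spec}(S)$ is a prime ideal of $S$, then $S/\mathfrak{q}=(R/(\mathfrak{q}\cap R))^+$, i.e. $S/\mathfrak{q}$ is, up to isomorphism of $R/(\mathfrak{q}\cap R)$-algebras, the absolute integral closure of the domain $R/(\mathfrak{q}\cap R)$.
   Context: All rings are commutative and unital. A ring extension $R\subseteq S$ is tight if every non-zero ideal of $S$ has non-zero intersection with $R$. A ring $S$ is absolutely integrally closed (ai closed) if every monic polynomial in $S[X]$ factorizes as a product of monic linear polynomials in $S[X]$ (uniqueness of the factorization is not required). An absolute integral closure (aic) of $R$ is an extension ring $S\supseteq R$ that is ai closed, integral over $R$ and tight over $R$. For an integral domain $D$, $D^+$ denotes the integral closure of $D$ in an algebraic closure of its field of fractions; it is the unique aic of $D$ up to isomorphism of $D$-algebras. *)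

theory Defs
  imports "HOL-Algebra.Algebraic_Closure"
begin

text \<open>A ring extension is given by a commutative ring \<open>S\<close> and a set \<open>R\<close> with \<open>subring R S\<close>;
  the ring \<open>R\<close> itself is then \<open>S\<lparr>carrier := R\<rparr>\<close>.\<close>

text \<open>Polynomials over \<open>A\<close> are normalised coefficient lists, so the zero polynomial is \<open>[]\<close>.
  The leading coefficient is taken with \<open>ring.coeff\<close> because \<open>hd []\<close> is unspecified:
  \<open>[]\<close> has leading coefficient zero here, and is monic only over the zero ring.\<close>

definition monic_poly :: "('a, 'b) ring_scheme \<Rightarrow> 'a set \<Rightarrow> 'a list \<Rightarrow> bool" where
  "monic_poly S A p \<longleftrightarrow> p \<in> carrier (A[X]\<^bsub>S\<^esub>) \<and> ring.coeff S p (degree p) = \<one>\<^bsub>S\<^esub>"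

definition ai_closed :: "('a, 'b) ring_scheme \<Rightarrow> bool" where
  "ai_closed S \<longleftrightarrow>
     (\<forall>p. monic_poly S (carrier S) p \<longrightarrow>
        (\<exists>as. set as \<subseteq> carrier S \<and>
           p = foldr (\<lambda>a q. [\<one>\<^bsub>S\<^esub>, \<ominus>\<^bsub>S\<^esub> a] \<otimes>\<^bsub>poly_ring S\<^esub> q) as \<one>\<^bsub>poly_ring S\<^esub>))"

definition integral_over :: "('a, 'b) ring_scheme \<Rightarrow> 'a set \<Rightarrow> 'a \<Rightarrow> bool" where
  "integral_over S A x \<longleftrightarrow> (\<exists>p. monic_poly S A p \<and> ring.eval S p x = \<zero>\<^bsub>S\<^esub>)"

definition integral_closure :: "('a, 'b) ring_scheme \<Rightarrow> 'a set \<Rightarrow> 'a set" where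
  "integral_closure S A = {x \<in> carrier S. integral_over S A x}"

definition tight :: "'a set \<Rightarrow> ('a, 'b) ring_scheme \<Rightarrow> bool" where
  "tight R S \<longleftrightarrow> (\<forall>I. ideal I S \<and> I \<noteq> {\<zero>\<^bsub>S\<^esub>} \<longrightarrow> I \<inter> R \<noteq> {\<zero>\<^bsub>S\<^esub>})"

definition aic :: "'a set \<Rightarrow> ('a, 'b) ring_scheme \<Rightarrow> bool" where
  "aic R S \<longleftrightarrow> cring S \<and> subring R S \<and> ai_closed S \<and>
     (\<forall>x\<in>carrier S. integral_over S R x) \<and> tight R S"

definition fractions :: "('a, 'b) ring_scheme \<Rightarrow> 'a set \<Rightarrow> 'a set" where
  "fractions L A = {a \<otimes>\<^bsub>L\<^esub> inv\<^bsub>L\<^esub> b | a b. a \<in> A \<and> b \<in> A \<and> b \<noteq> \<zero>\<^bsub>L\<^esub>}"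

text \<open>\<open>L\<close>, with the embedding \<open>\<iota>\<close> of \<open>D\<close>, is an algebraic closure of the field of fractions
  of \<open>D\<close>, the latter being realised inside \<open>L\<close>. A ring \<open>D\<close> that embeds into the field \<open>L\<close>
  is a domain, so this is not required separately.\<close>

definition alg_closure_of_fractions ::
    "('d, 'm) ring_scheme \<Rightarrow> ('d \<Rightarrow> 'c) \<Rightarrow> ('c, 'n) ring_scheme \<Rightarrow> bool" where
  "alg_closure_of_fractions D \<iota> L \<longleftrightarrow>
     \<iota> \<in> ring_hom D L \<and> inj_on \<iota> (carrier D) \<and>
     algebraic_closure L (fractions L (\<iota> ` carrier D))"

text \<open>The ring \<open>D\<^sup>+\<close> formed inside such an \<open>L\<close>; it is a \<open>D\<close>-algebra via \<open>\<iota>\<close>.\<close>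

definition domain_plus ::
    "('d, 'm) ring_scheme \<Rightarrow> ('d \<Rightarrow> 'c) \<Rightarrow> ('c, 'n) ring_scheme \<Rightarrow> ('c, 'n) ring_scheme" where
  "domain_plus D \<iota> L = L\<lparr>carrier := integral_closure L (\<iota> ` carrier D)\<rparr>"

text \<open>A \<open>D\<close>-algebra is a ring \<open>A\<close> together with a structure homomorphism \<open>f\<close> from \<open>D\<close> to \<open>A\<close>.\<close>

definition algebra_isomorphic ::
    "('d, 'm) ring_scheme \<Rightarrow> ('d \<Rightarrow> 'a) \<Rightarrow> ('a, 'k) ring_scheme \<Rightarrow>
     ('d \<Rightarrow> 'b) \<Rightarrow> ('b, 'l) ring_scheme \<Rightarrow> bool" where
  "algebra_isomorphic D f A g B \<longleftrightarrow>
     f \<in> ring_hom D A \<and> g \<in> ring_hom D B \<and>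
     (\<exists>\<phi> \<in> ring_iso A B. \<forall>d \<in> carrier D. \<phi> (f d) = g d)"

text \<open>The canonical map from \<open>R/(\<qq> \<inter> R)\<close> to \<open>S/\<qq>\<close> sends the coset \<open>(\<qq> \<inter> R) + r\<close> to \<open>\<qq> + r\<close>,
  which is the sum of the sets \<open>\<qq>\<close> and \<open>(\<qq> \<inter> R) + r\<close>.\<close>

definition contraction_quotient :: "'a set \<Rightarrow> ('a, 'b) ring_scheme \<Rightarrow> 'a set \<Rightarrow> 'a set ring" where
  "contraction_quotient R S \<qq> = S\<lparr>carrier := R\<rparr> Quot (\<qq> \<inter> R)"

definition quotient_map :: "('a, 'b) ring_scheme \<Rightarrow> 'a set \<Rightarrow> 'a set \<Rightarrow> 'a set" where
  "quotient_map S \<qq> = (\<lambda>C. \<qq> <+>\<^bsub>S\<^esub> C)"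

end

theory Submission
  imports Defs "HOL-Algebra.Chinese_Remainder"
begin

text \<open>Let \<open>j\<close> be the map \<open>R \<rightarrow> R/(\<qq> \<inter> R) \<rightarrow> L\<close>. By Zorn's lemma there is a maximal subring \<open>G\<close> of
  \<open>S \<times> L\<close> that contains the graph of \<open>j\<close> and in which \<open>(s, y) \<in> G\<close>, \<open>s \<in> \<qq>\<close> force \<open>y = 0\<close>;
  it is the graph of a homomorphism \<open>\<psi>\<close> from \<open>S\<close> to \<open>L\<close> extending \<open>j\<close>. Integrality of \<open>S\<close> over \<open>R\<close>
  makes \<open>\<qq>\<close> the whole kernel of \<open>\<psi>\<close> and its values integral over \<open>j(R)\<close>. Conversely, a monic
  polynomial over \<open>j(R)\<close> lifts to \<open>R\<close>, splits into linear factors over \<open>S\<close>, and hence has all its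
  roots in the image of \<open>\<psi>\<close>.\<close>

section \<open>Componentwise arithmetic in a product of two rings\<close>

lemma RDirProd_simps:
  "(a, b) \<otimes>\<^bsub>RDirProd S T\<^esub> (c, d) = (a \<otimes>\<^bsub>S\<^esub> c, b \<otimes>\<^bsub>T\<^esub> d)"
  "(a, b) \<oplus>\<^bsub>RDirProd S T\<^esub> (c, d) = (a \<oplus>\<^bsub>S\<^esub> c, b \<oplus>\<^bsub>T\<^esub> d)"
  "\<one>\<^bsub>RDirProd S T\<^esub> = (\<one>\<^bsub>S\<^esub>, \<one>\<^bsub>T\<^esub>)"
  "\<zero>\<^bsub>RDirProd S T\<^esub> = (\<zero>\<^bsub>S\<^esub>, \<zero>\<^bsub>T\<^esub>)"
  by (simp_all add: RDirProd_def DirProd_def monoid.defs)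

lemma RDirProd_cring:
  assumes "cring S" and "cring T"
  shows "cring (RDirProd S T)"
proof -
  interpret S: cring S by fact
  interpret T: cring T by fact
  interpret ring "RDirProd S T"
    by (rule RDirProd_ring) (rule S.ring_axioms T.ring_axioms)+
  show ?thesis
    by unfold_locales (auto simp: RDirProd_carrier RDirProd_simps S.m_comm T.m_comm)
qed

lemma RDirProd_fst_hom: "fst \<in> ring_hom (RDirProd S T) S"
  by (rule ring_hom_memI) (auto simp: RDirProd_carrier RDirProd_simps)

lemma RDirProd_snd_hom: "snd \<in> ring_hom (RDirProd S T) T"
  by (rule ring_hom_memI) (auto simp: RDirProd_carrier RDirProd_simps)

lemma RDirProd_a_inv:
  assumes "ring S" "ring T" "a \<in> carrier S" "b \<in> carrier T"
  shows "\<ominus>\<^bsub>RDirProd S T\<^esub> (a, b) = (\<ominus>\<^bsub>S\<^esub> a, \<ominus>\<^bsub>T\<^esub> b)"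
proof -
  interpret S: ring S by fact
  interpret T: ring T by fact
  interpret ring "RDirProd S T"
    by (rule RDirProd_ring) fact+
  show ?thesis
    using assms(3,4) by (intro minus_equality) (auto simp: RDirProd_simps RDirProd_carrier S.l_neg T.l_neg)
qed

section \<open>Values of polynomials over a subring\<close>

lemma (in ring) eval_in_subring:
  assumes "subring K R" "set p \<subseteq> K" "x \<in> K"
  shows "eval p x \<in> K"
  using ring.eval_in_carrier[OF subring_is_ring[OF assms(1)], of p x] assms
  by simp

text \<open>Every element of \<open>simple_extension K x\<close> is the value at \<open>x\<close> of
  a coefficient list over \<open>K\<close>, so sums and products of elements are values of sums and
  products of lists. This is what enlarges a subring of the product by one pair.\<close>

lemma (in cring) simple_extension_subring:
  assumes K: "subring K R" and x: "x \<in> carrier R"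
  shows "subring (simple_extension K x) R"
proof -
  interpret K: cring "R\<lparr>carrier := K\<rparr>"
    using subcring_iff[OF subringE(1)[OF K]] subcringI'[OF K] by blast
  note incl = subringE(1)[OF K]
  \<comment> \<open>The description by normalised polynomials is loosened to arbitrary lists over
    \<open>K\<close>: leading zeros do not change a value.\<close>
  have *: "simple_extension K x = {eval p x | p. set p \<subseteq> K}"
  proof (intro equalityI subsetI)
    fix a assume "a \<in> simple_extension K x"
    then show "a \<in> {eval p x | p. set p \<subseteq> K}"
      using polynomial_incl
      by (fastforce simp: simple_extension_as_eval_img[OF incl x] univ_poly_carrier[symmetric])
  next
    fix a assume "a \<in> {eval p x | p. set p \<subseteq> K}"
    then obtain p where p: "set p \<subseteq> K" "a = eval p x" by blast
    then have "eval (normalize p) x = a"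
      using eval_normalize[of p x] incl x by auto
    then show "a \<in> simple_extension K x"
      using normalize_gives_polynomial[OF p(1)]
      by (auto simp: simple_extension_as_eval_img[OF incl x] univ_poly_carrier[symmetric])
  qed
  have mult: "a \<otimes> b \<in> simple_extension K x"
    if "a \<in> simple_extension K x" "b \<in> simple_extension K x" for a b
  proof -
    obtain p q where pq: "set p \<subseteq> K" "a = eval p x" "set q \<subseteq> K" "b = eval q x"
      using \<open>a \<in> simple_extension K x\<close> \<open>b \<in> simple_extension K x\<close> unfolding * by blast
    have "a \<otimes> b = eval (poly_mult p q) x"
      using eval_poly_mult[of p q x] pq incl x by auto
    moreover have "set (poly_mult p q) \<subseteq> K"
      using K.poly_mult_in_carrier[of p q] pq by (simp add: poly_mult_consistent[OF K])
    ultimately show ?thesis unfolding * by blast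
  qed
  have add: "a \<oplus> b \<in> simple_extension K x"
    if "a \<in> simple_extension K x" "b \<in> simple_extension K x" for a b
  proof -
    obtain p q where pq: "set p \<subseteq> K" "a = eval p x" "set q \<subseteq> K" "b = eval q x"
      using \<open>a \<in> simple_extension K x\<close> \<open>b \<in> simple_extension K x\<close> unfolding * by blast
    have "a \<oplus> b = eval (poly_add p q) x"
      using eval_poly_add[of p q x] pq incl x by auto
    moreover have "set (poly_add p q) \<subseteq> K"
      using K.poly_add_in_carrier[of p q] pq 
      by (simp add: poly_add_consistent[OF K] del: poly_add.simps)
    ultimately show ?thesis unfolding * by blast
  qed
  have one: "\<one> \<in> simple_extension K x"
    using simple_extension_incl[OF incl x] subringE(3)[OF K] by blast
  have m1: "\<ominus> \<one> \<in> simple_extension K x"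
    using simple_extension_incl[OF incl x] subringE(3,5)[OF K] by blast
  show ?thesis
  proof (rule subringI)
    show "simple_extension K x \<subseteq> carrier R"
      by (rule simple_extension_in_carrier[OF incl x])
    then show "\<ominus> h \<in> simple_extension K x" if "h \<in> simple_extension K x" for h
      using mult[OF m1 that] that by (auto simp: l_minus)
  qed (use one mult add in auto)
qed

text \<open>One step of pseudo-division: if \<open>a\<close> and \<open>c\<close> are the leading
  coefficients of \<open>p\<close> and \<open>q\<close>, the combination cancels the leading terms
  without inverting \<open>c\<close>. The lists are combined entrywise and not normalised, so their
  length stays known.\<close>

lemma (in cring) eval_map2_diff:
  assumes "length p = length q" "set p \<subseteq> carrier R" "set q \<subseteq> carrier R"
    "c \<in> carrier R" "a \<in> carrier R" "x \<in> carrier R"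
  shows "eval (map2 (\<lambda>u v. c \<otimes> u \<ominus> a \<otimes> v) p q) x = c \<otimes> eval p x \<ominus> a \<otimes> eval q x"
  using assms
proof (induction p q rule: list_induct2)
  case Nil
  then show ?case by (simp add: minus_eq)
next
  case (Cons u p v q)
  have carr: "eval p x \<in> carrier R" "eval q x \<in> carrier R" "x [^] length q \<in> carrier R"
    "u \<in> carrier R" "v \<in> carrier R" "c \<in> carrier R" "a \<in> carrier R"
    using Cons.prems by (auto intro: eval_in_carrier)
  have "eval (map2 (\<lambda>u v. c \<otimes> u \<ominus> a \<otimes> v) (u # p) (v # q)) x
    = (c \<otimes> u \<ominus> a \<otimes> v) \<otimes> x [^] length q \<oplus> (c \<otimes> eval p x \<ominus> a \<otimes> eval q x)"
    using Cons by simp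
  also have "\<dots> = c \<otimes> (u \<otimes> x [^] length q \<oplus> eval p x) \<ominus> a \<otimes> (v \<otimes> x [^] length q \<oplus> eval q x)"
    using carr by algebra
  finally show ?case
    using Cons.hyps by simp
qed

section \<open>Evaluation of polynomials along a ring homomorphism\<close>

lemma (in ring_hom_ring) eval_map_normalize:
  assumes "set p \<subseteq> carrier R" "y \<in> carrier S"
  shows "S.eval (map h (R.normalize p)) y = S.eval (map h p) y"
proof -
  have "set (map h p) \<subseteq> carrier S" if "set p \<subseteq> carrier R" for p
    using that by auto
  then show ?thesis
    using assms by (induction p) (auto simp: S.eval_in_carrier)
qed

text \<open>Padding with leading zeros and stripping them leaves values unchanged, and
  \<open>h\<close> preserves zeros and entrywise sums. The claim is about values and not about
  polynomials, since \<open>h\<close> may kill leading coefficients and \<open>map h p\<close> need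
  not be normalised.\<close>

lemma (in ring_hom_ring) eval_map_poly_add:
  assumes "set p \<subseteq> carrier R" "set q \<subseteq> carrier R" "y \<in> carrier S"
  shows "S.eval (map h (R.poly_add p q)) y = S.eval (map h p) y \<oplus>\<^bsub>S\<^esub> S.eval (map h q) y"
proof -
  have *: "S.eval (map h (R.poly_add p q)) y = S.eval (map h p) y \<oplus>\<^bsub>S\<^esub> S.eval (map h q) y"
    if pq: "set p \<subseteq> carrier R" "set q \<subseteq> carrier R" "length q \<le> length p" for p q
  proof -
    \<comment> \<open>These are the leading zeros that \<open>poly_add\<close> itself inserts to
      align the shorter list with \<open>p\<close>.\<close>
    define q' where "q' = replicate (length p - length q) \<zero>\<^bsub>R\<^esub> @ q"
    have q': "set q' \<subseteq> carrier R" "length p = length q'"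
      using pq by (auto simp: q'_def)
    have *: "set (map2 (\<oplus>\<^bsub>R\<^esub>) p q') \<subseteq> carrier R"
      using q'(2,1) pq(1) by (induction p q' rule: list_induct2) auto
    have "S.eval (map h (R.poly_add p q)) y = S.eval (map h (map2 (\<oplus>\<^bsub>R\<^esub>) p q')) y"
      using pq(3) eval_map_normalize[OF * assms(3)] by (simp add: q'_def)
    also have "map h (map2 (\<oplus>\<^bsub>R\<^esub>) p q') = map2 (\<oplus>\<^bsub>S\<^esub>) (map h p) (map h q')"
      using q'(2,1) pq(1) by (induction p q' rule: list_induct2) auto
    also have "S.eval \<dots> y = S.eval (S.normalize \<dots>) y"
    proof (rule S.eval_normalize[symmetric])
      show "set (map2 (\<oplus>\<^bsub>S\<^esub>) (map h p) (map h q')) \<subseteq> carrier S"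
        unfolding calculation using q'(2,1) pq(1)
        by (induction p q' rule: list_induct2) auto
    qed (fact assms)
    also have "\<dots> = S.eval (S.poly_add (map h p) (map h q')) y"
      using q'(2) by simp
    also have "\<dots> = S.eval (map h p) y \<oplus>\<^bsub>S\<^esub> S.eval (map h q') y"
      using pq q' assms(3) by (intro S.eval_poly_add) auto
    also have "S.eval (map h q') y = S.eval (map h q) y"
    proof -
      have "set (map h q) \<subseteq> carrier S" using pq by auto
      then show ?thesis using S.eval_replicate[OF _ assms(3), of "map h q"] by (simp add: q'_def)
    qed
    finally show ?thesis .
  qed
  show ?thesis
  proof (cases "length q \<le> length p")
    case True
    then show ?thesis using * assms by blast
  next
    case False
    then have "R.poly_add p q = R.poly_add q p" by simp
    moreover have "set (map h p) \<subseteq> carrier S" "set (map h q) \<subseteq> carrier S"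
      using assms by auto
    ultimately show ?thesis
      using *[OF assms(2,1)] False assms(3)
      by (simp add: S.add.m_comm S.eval_in_carrier del: R.poly_add.simps)
  qed
qed

text \<open>The product unfolds into \<open>q\<close> shifted by one place plus \<open>q\<close>
  scaled by the negative of \<open>a\<close>. Under \<open>h\<close> and evaluation, the shift
  becomes multiplication by \<open>y\<close> and the scaling becomes multiplication by the negative
  of \<open>h a\<close>.\<close>

lemma (in ring_hom_cring) eval_map_linear_mult:
  assumes "a \<in> carrier R" "set q \<subseteq> carrier R" "y \<in> carrier S"
  shows "S.eval (map h (R.poly_mult [\<one>\<^bsub>R\<^esub>, \<ominus>\<^bsub>R\<^esub> a] q)) y
    = (y \<ominus>\<^bsub>S\<^esub> h a) \<otimes>\<^bsub>S\<^esub> S.eval (map h q) y"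
proof -
  have scale: "S.eval (map h (map ((\<otimes>\<^bsub>R\<^esub>) b) q)) y = h b \<otimes>\<^bsub>S\<^esub> S.eval (map h q) y"
    if "b \<in> carrier R" for b
    using assms(2)
  proof (induction q)
    case (Cons c q)
    have "set (map h q) \<subseteq> carrier S"
      using Cons.prems by auto
    then have "S.eval (map h q) y \<in> carrier S"
      using assms by (intro S.eval_in_carrier)
    then show ?case
      using Cons that assms by (simp add: S.m_assoc S.r_distr)
  qed (use that in simp)
  have id: "map ((\<otimes>\<^bsub>R\<^esub>) \<one>\<^bsub>R\<^esub>) q = q"
    using assms(2) by (induction q) auto
  let ?m = "map ((\<otimes>\<^bsub>R\<^esub>) (\<ominus>\<^bsub>R\<^esub> a)) q"
  have m: "set ?m \<subseteq> carrier R"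
    using assms by auto
  have pm: "set (R.poly_add ?m []) \<subseteq> carrier R"
    by (rule R.poly_add_in_carrier[OF m]) simp
  have hq: "set (map h q) \<subseteq> carrier S"
    using assms by auto
  then have E: "S.eval (map h q) y \<in> carrier S"
    using assms by (intro S.eval_in_carrier)
  have "S.eval (map h (R.poly_mult [\<one>\<^bsub>R\<^esub>, \<ominus>\<^bsub>R\<^esub> a] q)) y
    = S.eval (map h (R.poly_add (q @ [\<zero>\<^bsub>R\<^esub>]) (R.poly_add ?m []))) y"
    by (simp add: id del: R.poly_add.simps)
  also have "\<dots> = S.eval (map h (q @ [\<zero>\<^bsub>R\<^esub>])) y \<oplus>\<^bsub>S\<^esub> S.eval (map h (R.poly_add ?m [])) y"
    using assms pm by (intro ring.eval_map_poly_add) auto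
  also have "S.eval (map h (R.poly_add ?m [])) y = h (\<ominus>\<^bsub>R\<^esub> a) \<otimes>\<^bsub>S\<^esub> S.eval (map h q) y"
    using ring.eval_map_poly_add[OF m, of "[]" y] assms E scale[of "\<ominus>\<^bsub>R\<^esub> a"]
    by (simp del: R.poly_add.simps)
  also have "S.eval (map h (q @ [\<zero>\<^bsub>R\<^esub>])) y = S.eval (map h q) y \<otimes>\<^bsub>S\<^esub> y"
    using S.eval_append_aux[OF hq, of "\<zero>\<^bsub>S\<^esub>" y] assms E by simp
  also have "S.eval (map h q) y \<otimes>\<^bsub>S\<^esub> y \<oplus>\<^bsub>S\<^esub> h (\<ominus>\<^bsub>R\<^esub> a) \<otimes>\<^bsub>S\<^esub> S.eval (map h q) y
    = (y \<ominus>\<^bsub>S\<^esub> h a) \<otimes>\<^bsub>S\<^esub> S.eval (map h q) y"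
    using assms E hom_closed[OF assms(1)]
    by (simp add: S.minus_eq S.l_distr S.m_comm[of "S.eval (map h q) y" y])
  finally show ?thesis .
qed

section \<open>Partial homomorphisms from \<open>S\<close> to \<open>L\<close>\<close>

text \<open>Here \<open>j\<close> stands for the composite of R \<rightarrow> R/(\<qq> \<inter> R)
  with an embedding into \<open>L\<close>, and \<open>j_kernel\<close> expresses that the second map
  is injective.\<close>

locale integral_lift =
  S: cring S + L: algebraically_closed L + q: primeideal \<qq> S
  for S :: "('a, 'b) ring_scheme" (structure)
    and L :: "('c, 'n) ring_scheme" and \<qq> :: "'a set" +
  fixes R :: "'a set" and j :: "'a \<Rightarrow> 'c"
  assumes R: "subring R S"
    and j_hom: "j \<in> ring_hom (S\<lparr>carrier := R\<rparr>) L"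
    and j_kernel: "r \<in> R \<Longrightarrow> j r = \<zero>\<^bsub>L\<^esub> \<longleftrightarrow> r \<in> \<qq>"
    and integral: "x \<in> carrier S \<Longrightarrow>
      \<exists>p. p \<noteq> [] \<and> hd p = \<one> \<and> set p \<subseteq> R \<and> S.eval p x = \<zero>"
begin

sublocale U: cring "RDirProd S L"
  by (rule RDirProd_cring) unfold_locales

abbreviation U where "U \<equiv> RDirProd S L"

text \<open>Such a \<open>G\<close> is the graph of a homomorphism on a subring of \<open>S\<close>.
  Single-valuedness is hidden in the last condition: the difference of \<open>(s, y)\<close> and
  \<open>(s, y')\<close> has first component zero, which lies in \<open>\<qq>\<close>, so
  \<open>y = y'\<close>.\<close>

definition partial_lift :: "('a \<times> 'c) set \<Rightarrow> bool" where
  "partial_lift G \<longleftrightarrow> subring G U \<and> (\<forall>r\<in>R. (r, j r) \<in> G) \<and> (\<forall>(s, y)\<in>G. s \<in> \<qq> \<longrightarrow> y = \<zero>\<^bsub>L\<^esub>)"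

lemma R_carrier: "R \<subseteq> carrier S"
  by (rule subringE(1)[OF R])

lemma one_notin: "\<one> \<notin> \<qq>"
  using q.I_notcarr q.one_imp_carrier by blast

lemma fst_eval:
  assumes "set p \<subseteq> carrier U" "x \<in> carrier S" "y \<in> carrier L"
  shows "fst (U.eval p (x, y)) = S.eval (map fst p) x"
proof -
  interpret ring_hom_ring U S fst
    by (rule ring_hom_ringI2) (unfold_locales, rule RDirProd_fst_hom)
  show ?thesis
    using eval_hom'[of "(x, y)" p] assms by (simp add: RDirProd_carrier)
qed

lemma snd_eval:
  assumes "set p \<subseteq> carrier U" "x \<in> carrier S" "y \<in> carrier L"
  shows "snd (U.eval p (x, y)) = L.eval (map snd p) y"
proof -
  interpret ring_hom_ring U L snd
    by (rule ring_hom_ringI2) (unfold_locales, rule RDirProd_snd_hom)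
  show ?thesis
    using eval_hom'[of "(x, y)" p] assms by (simp add: RDirProd_carrier)
qed

text \<open>Pairing each coefficient \<open>r\<close> with \<open>j r\<close> gives a polynomial
  over \<open>G\<close>; its value at \<open>(s, y)\<close> stays in the subring \<open>G\<close>
  and is computed componentwise.\<close>

lemma partial_lift_eval_graph:
  assumes G: "partial_lift G" and sy: "(s, y) \<in> G" and p: "set p \<subseteq> R"
  shows "(S.eval p s, L.eval (map j p) y) \<in> G"
proof -
  note GU = subringE(1)[OF G[unfolded partial_lift_def, THEN conjunct1]]
  have set: "set (map (\<lambda>r. (r, j r)) p) \<subseteq> G"
    using p G by (auto simp: partial_lift_def)
  have carr: "s \<in> carrier S" "y \<in> carrier L"
    using sy GU by (auto simp: RDirProd_carrier)
  have "U.eval (map (\<lambda>r. (r, j r)) p) (s, y) \<in> G"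
    using U.eval_in_subring[OF _ set sy] G by (simp add: partial_lift_def)
  moreover have "U.eval (map (\<lambda>r. (r, j r)) p) (s, y) = (S.eval p s, L.eval (map j p) y)"
    using fst_eval[OF subset_trans[OF set GU] carr] snd_eval[OF subset_trans[OF set GU] carr]
    by (simp add: prod_eq_iff comp_def)
  ultimately show ?thesis by simp
qed

text \<open>Evaluating a monic equation of \<open>s\<close> at the pair \<open>(s, 0)\<close> shows
  that \<open>j\<close> kills its constant term, which therefore lies in \<open>\<qq>\<close>. If
  \<open>s\<close> is outside \<open>\<qq>\<close>, primality allows division by \<open>s\<close>
  modulo \<open>\<qq>\<close>, giving a shorter monic equation. The descent ends with one in
  \<open>\<qq>\<close>.\<close>

lemma partial_lift_reflects_zero:
  assumes G: "partial_lift G" and s: "(s, \<zero>\<^bsub>L\<^esub>) \<in> G"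
  shows "s \<in> \<qq>"
proof (rule ccontr)
  assume notin: "s \<notin> \<qq>"
  have sS: "s \<in> carrier S"
    using s subringE(1)[OF G[unfolded partial_lift_def, THEN conjunct1]]
    by (auto simp: RDirProd_carrier)
  \<comment> \<open>The value is only required to lie in \<open>\<qq>\<close>, because this weaker
    property is what survives division by \<open>s\<close>.\<close>
  have False if "p \<noteq> []" "hd p = \<one>" "set p \<subseteq> R" "S.eval p s \<in> \<qq>" for p
    using that
  proof (induction p rule: rev_induct)
    case (snoc b p)
    have p: "set p \<subseteq> carrier S" "set p \<subseteq> R" and b: "b \<in> R" "b \<in> carrier S"
      using snoc.prems R_carrier by auto
    have jp: "set (map j p) \<subseteq> carrier L" "j b \<in> carrier L"
      using p(2) b(1) ring_hom_closed[OF j_hom] by auto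
    \<comment> \<open>Coefficients are listed from the leading one down, so the last entry
      \<open>b\<close> is the constant term and the value at zero.\<close>
    have "L.eval (map j (p @ [b])) \<zero>\<^bsub>L\<^esub> = j b"
      using L.eval_append_aux[OF jp, of "\<zero>\<^bsub>L\<^esub>"] L.eval_in_carrier[OF jp(1), of "\<zero>\<^bsub>L\<^esub>"] jp by simp
    then have "j b = \<zero>\<^bsub>L\<^esub>"
      using partial_lift_eval_graph[OF G s snoc.prems(3)] G snoc.prems(4)
      unfolding partial_lift_def by auto
    then have bq: "b \<in> \<qq>"
      using j_kernel b by simp
    define e where "e = S.eval p s"
    have e: "e \<in> carrier S"
      unfolding e_def using p sS by (intro S.eval_in_carrier)
    have "e \<otimes> s \<oplus> b \<in> \<qq>"
      using snoc.prems(4) S.eval_append_aux[OF p(1) b(2) sS] by (simp add: e_def)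
    moreover have "e \<otimes> s = (e \<otimes> s \<oplus> b) \<ominus> b"
      using e sS b by algebra
    ultimately have "e \<otimes> s \<in> \<qq>"
      using bq q.a_closed[of "e \<otimes> s \<oplus> b" "\<ominus> b"] q.a_inv_closed by (simp add: S.minus_eq)
    then have "e \<in> \<qq>"
      using q.I_prime e sS notin by blast
    show False
    proof (cases "p = []")
      case True
      then show False using snoc.prems(2) bq one_notin by simp
    next
      case False
      then show False
        using snoc.IH snoc.prems p \<open>e \<in> \<qq>\<close> by (simp add: e_def)
    qed
  qed simp
  then show False
    using integral[OF sS] q.zero_closed by metis
qed

section \<open>Adjoining one element of \<open>S\<close> to a partial homomorphism\<close>

lemma root_exists:
  assumes "set p \<subseteq> carrier L" "hd p \<noteq> \<zero>\<^bsub>L\<^esub>" "2 \<le> length p"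
  obtains y where "y \<in> carrier L" "L.eval p y = \<zero>\<^bsub>L\<^esub>"
proof -
  have p: "p \<in> carrier (poly_ring L)"
    using assms by (auto simp: univ_poly_carrier[symmetric] polynomial_def)
  have "size (L.roots p) = degree p"
    using L.roots_over_carrier[OF p] by (simp add: L.splitted_def)
  then have "L.roots p \<noteq> {#}"
    using assms(3) by auto
  then obtain y where "y \<in># L.roots p"
    by blast
  then show ?thesis
    using L.roots_mem_iff_is_root[OF p] that by (auto simp: L.is_root_def)
qed

text \<open>The new element \<open>x\<close> is paired with a root \<open>y\<close> of a polynomial \<open>g\<close> over \<open>G\<close> of least
  degree that vanishes at \<open>x\<close> modulo \<open>\<qq>\<close>; pseudo-division by \<open>g\<close> shows that every
  polynomial over \<open>G\<close> vanishing at \<open>x\<close> modulo \<open>\<qq>\<close> vanishes at \<open>y\<close>.\<close>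

lemma partial_lift_extend:
  assumes G: "partial_lift G" and x: "x \<in> carrier S"
  obtains G' y where "partial_lift G'" "G \<subseteq> G'" "(x, y) \<in> G'"
proof -
  have subG: "subring G U"
    using G by (simp add: partial_lift_def)
  note GU = subringE(1)[OF subG]
  \<comment> \<open>A coefficient in \<open>G\<close> is a pair: its first component acts on
    \<open>x\<close>, its second on the sought \<open>y\<close>. Leading coefficients outside
    \<open>\<qq>\<close> are those that are non-zero modulo \<open>\<qq>\<close>.\<close>
  define van where "van p \<longleftrightarrow> set p \<subseteq> G \<and> p \<noteq> [] \<and> fst (hd p) \<notin> \<qq> \<and> S.eval (map fst p) x \<in> \<qq>" for p
  obtain p where p: "p \<noteq> []" "hd p = \<one>" "set p \<subseteq> R" "S.eval p x = \<zero>"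
    using integral[OF x] by blast
  \<comment> \<open>An integral equation of \<open>x\<close> over \<open>R\<close>, read over
    \<open>G\<close>, shows that a polynomial of least length exists.\<close>
  have "van (map (\<lambda>r. (r, j r)) p)"
    using p G one_notin by (auto simp: van_def partial_lift_def hd_map comp_def)
  then obtain g where g: "van g" and least: "\<And>p. van p \<Longrightarrow> length g \<le> length p"
    using ex_has_least_nat[of van _ length] by blast
  have gG: "set g \<subseteq> G" and gU: "set g \<subseteq> carrier U"
    using g GU by (auto simp: van_def)
  define c where "c = hd g"
  define g1 where "g1 = tl g"
  have g_eq: "g = c # g1"
    using g by (simp add: van_def c_def g1_def)
  have c: "c \<in> G" "fst c \<notin> \<qq>" "fst c \<in> carrier S" "snd c \<in> carrier L"
    using g gU by (auto simp: van_def g_eq RDirProd_carrier)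
  \<comment> \<open>If the second component were zero, \<open>partial_lift_reflects_zero\<close>
    would put \<open>fst c\<close> into \<open>\<qq>\<close>.\<close>
  have c0: "snd c \<noteq> \<zero>\<^bsub>L\<^esub>"
    using partial_lift_reflects_zero[OF G, of "fst c"] c by (metis prod.collapse)
  \<comment> \<open>A constant \<open>g\<close> would have value \<open>fst c\<close>, which is not
    in \<open>\<qq>\<close>. Hence the image of \<open>g\<close> over \<open>L\<close> has positive
    degree and a root.\<close>
  have "g1 \<noteq> []"
    using g c by (auto simp: van_def g_eq)
  then have "hd (map snd g) \<noteq> \<zero>\<^bsub>L\<^esub>" "2 \<le> length (map snd g)"
    using c0 by (simp_all add: g_eq Suc_le_eq)
  moreover have "set (map snd g) \<subseteq> carrier L"
    using gU by (auto simp: RDirProd_carrier)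
  ultimately obtain y where y: "y \<in> carrier L" "L.eval (map snd g) y = \<zero>\<^bsub>L\<^esub>"
    using root_exists by blast
  define z where "z = (x, y)"
  have z: "z \<in> carrier U"
    using x y by (simp add: z_def RDirProd_carrier)
  have fst_z: "fst (U.eval p z) = S.eval (map fst p) x"
    and snd_z: "snd (U.eval p z) = L.eval (map snd p) y" if "set p \<subseteq> carrier U" for p
    using fst_eval[OF that x y(1)] snd_eval[OF that x y(1)] by (simp_all add: z_def)
  have evalU: "U.eval p z \<in> carrier U" if "set p \<subseteq> carrier U" for p
    using U.eval_in_carrier[OF that z] .
  have vanish: "snd (U.eval h z) = \<zero>\<^bsub>L\<^esub>" if "set h \<subseteq> G" "fst (U.eval h z) \<in> \<qq>" for h
    using that
  proof (induction "length h" arbitrary: h rule: less_induct)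
    case less
    show ?case
    proof (cases h)
      case Nil
      then show ?thesis by (simp add: RDirProd_simps)
    next
      case (Cons a h1)
      have hU: "set h \<subseteq> carrier U" and a: "a \<in> G" "a \<in> carrier U" 
        and h1: "set h1 \<subseteq> G" "set h1 \<subseteq> carrier U"
        using less.prems GU Cons by auto
      obtain a1 a2 where a12: "a = (a1, a2)" by fastforce
      obtain e1 e2 where e: "U.eval h1 z = (e1, e2)" by fastforce
      obtain z1 z2 where zz: "z [^]\<^bsub>U\<^esub> length h1 = (z1, z2)" by fastforce
      have carr: "a1 \<in> carrier S" "a2 \<in> carrier L" "e1 \<in> carrier S" "e2 \<in> carrier L"
        "z1 \<in> carrier S" "z2 \<in> carrier L"
        using evalU[OF h1(2)] a U.nat_pow_closed[OF z, of "length h1"]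
        by (auto simp: a12 e zz RDirProd_carrier)
      show ?thesis
      proof (cases "a1 \<in> \<qq>")
        case True
        \<comment> \<open>A leading coefficient over \<open>\<qq>\<close> has second component zero,
          so dropping its term changes the first value only by an element of \<open>\<qq>\<close>
          and the second not at all.\<close>
        then have "a2 = \<zero>\<^bsub>L\<^esub>"
          using a(1) G by (auto simp: partial_lift_def a12)
        then have snd: "snd (U.eval h z) = e2"
          using carr by (simp add: Cons e a12 zz RDirProd_simps)
        have "a1 \<otimes> z1 \<oplus> e1 \<in> \<qq>"
          using less.prems(2) by (simp add: Cons e a12 zz RDirProd_simps)
        moreover have "a1 \<otimes> z1 \<in> \<qq>"
          using True carr q.I_r_closed by blast
        moreover have "e1 = (a1 \<otimes> z1 \<oplus> e1) \<ominus> a1 \<otimes> z1"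
          using carr by algebra
        ultimately have "e1 \<in> \<qq>"
          using q.a_closed q.a_inv_closed by (metis S.minus_eq)
        then show ?thesis
          using less.hyps[of h1] h1 snd by (simp add: Cons e)
      next
        case False
        have "van h"
          using less.prems False fst_z[OF hU] by (auto simp: van_def Cons a12)
        then have le: "length g \<le> length h"
          by (rule least)
        define k where "k = length h - length g"
        \<comment> \<open>Appending \<open>k\<close> zeros multiplies \<open>g\<close> by the
          \<open>k\<close>-th power of the variable, bringing it to the length of
          \<open>h\<close>.\<close>
        define g' where "g' = g @ replicate k \<zero>\<^bsub>U\<^esub>"
        \<comment> \<open>The leading position, where \<open>c a - a c\<close> cancels, is left out,
          so \<open>h'\<close> is strictly shorter than \<open>h\<close>.\<close>
        define h' where "h' = map2 (\<lambda>u v. c \<otimes>\<^bsub>U\<^esub> u \<ominus>\<^bsub>U\<^esub> a \<otimes>\<^bsub>U\<^esub> v) h1 (tl g')"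
        have cU: "c \<in> carrier U"
          using c GU by auto
        have g'G: "set g' \<subseteq> G"
          using gG subringE(2)[OF subG] by (auto simp: g'_def)
        then have g'U: "set g' \<subseteq> carrier U"
          using GU by blast
        have len: "length h1 = length (tl g')"
          using le by (simp add: g'_def g_eq Cons k_def)
        have "set h' \<subseteq> G"
        proof -
          have "c \<otimes>\<^bsub>U\<^esub> u \<ominus>\<^bsub>U\<^esub> a \<otimes>\<^bsub>U\<^esub> v \<in> G" if "u \<in> G" "v \<in> G" for u v
            using that c(1) a(1) subringE(5-7)[OF subG] by (simp add: U.minus_eq)
          moreover have "set (tl g') \<subseteq> G"
            using g'G by (cases g') auto
          ultimately show ?thesis
            using h1(1) unfolding h'_def
            by (auto simp del: split_paired_All) (meson set_zip_leftD set_zip_rightD subsetD)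
        qed
        have "U.eval h' z = U.eval (map2 (\<lambda>u v. c \<otimes>\<^bsub>U\<^esub> u \<ominus>\<^bsub>U\<^esub> a \<otimes>\<^bsub>U\<^esub> v) h g') z"
        proof -
          have "c \<otimes>\<^bsub>U\<^esub> a \<ominus>\<^bsub>U\<^esub> a \<otimes>\<^bsub>U\<^esub> c = \<zero>\<^bsub>U\<^esub>"
            using cU a by (simp add: U.m_comm U.minus_eq U.r_neg)
          moreover have "U.eval h' z \<in> carrier U"
            using \<open>set h' \<subseteq> G\<close> GU by (intro evalU) blast
          ultimately show ?thesis
            using U.nat_pow_closed[OF z] by (simp add: Cons g_eq g'_def h'_def)
        qed
        also have "\<dots> = c \<otimes>\<^bsub>U\<^esub> U.eval h z \<ominus>\<^bsub>U\<^esub> a \<otimes>\<^bsub>U\<^esub> U.eval g' z"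
        proof (rule U.eval_map2_diff)
          show "length h = length g'"
            using le by (simp add: g'_def k_def)
        qed (use hU g'U cU a z in auto)
        also have "U.eval g' z = U.eval g z \<otimes>\<^bsub>U\<^esub> z [^]\<^bsub>U\<^esub> k"
        proof -
          have "U.eval (replicate k \<zero>\<^bsub>U\<^esub>) z = \<zero>\<^bsub>U\<^esub>"
            using U.eval_replicate[of "[]" z k] z by simp
          moreover have "set (replicate k \<zero>\<^bsub>U\<^esub>) \<subseteq> carrier U"
            by (auto simp: set_replicate_conv_if)
          ultimately show ?thesis
            using U.eval_append[OF gU _ z, of "replicate k \<zero>\<^bsub>U\<^esub>"] evalU[OF gU] z
            by (simp add: g'_def)
        qed
        finally have h': "U.eval h' z
          = c \<otimes>\<^bsub>U\<^esub> U.eval h z \<ominus>\<^bsub>U\<^esub> a \<otimes>\<^bsub>U\<^esub> (U.eval g z \<otimes>\<^bsub>U\<^esub> z [^]\<^bsub>U\<^esub> k)" .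
        obtain w1 w2 where w: "U.eval h z = (w1, w2)" by fastforce
        obtain v1 v2 where v: "z [^]\<^bsub>U\<^esub> k = (v1, v2)" by fastforce
        obtain c1 c2 where c12: "c = (c1, c2)" by fastforce
        obtain f where f: "U.eval g z = (f, \<zero>\<^bsub>L\<^esub>)" "f \<in> \<qq>"
          using fst_z[OF gU] snd_z[OF gU] y g by (metis prod.collapse van_def)
        have carr': "w1 \<in> carrier S" "w2 \<in> carrier L" "v1 \<in> carrier S" "v2 \<in> carrier L"
          "c1 \<in> carrier S" "c2 \<in> carrier L" "f \<in> carrier S"
          using evalU[OF hU] U.nat_pow_closed[OF z, of k] c f
          by (auto simp: w v c12 RDirProd_carrier q.Icarr)
        \<comment> \<open>Since \<open>y\<close> is a root, the value of \<open>g\<close> at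
          \<open>z\<close> has second component zero; the subtracted term affects only the first
          component, and there by an element of \<open>\<qq>\<close>.\<close>
        have h'2: "U.eval h' z = (c1 \<otimes> w1 \<ominus> a1 \<otimes> (f \<otimes> v1), c2 \<otimes>\<^bsub>L\<^esub> w2)"
          unfolding h' using carr carr'
          by (simp add: w v c12 a12 f RDirProd_simps U.minus_eq S.minus_eq
              RDirProd_a_inv[OF S.ring_axioms L.ring_axioms])
        have "w1 \<in> \<qq>"
          using less.prems(2) by (simp add: w)
        then have "c1 \<otimes> w1 \<in> \<qq>"
          using carr' q.I_l_closed by blast
        moreover have "a1 \<otimes> (f \<otimes> v1) \<in> \<qq>"
          using carr carr' f q.I_l_closed q.I_r_closed by blast
        ultimately have "fst (U.eval h' z) \<in> \<qq>"
          using q.a_closed q.a_inv_closed by (simp add: h'2 S.minus_eq)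
        moreover have "length h' < length h"
          by (simp add: h'_def Cons)
        ultimately have "c2 \<otimes>\<^bsub>L\<^esub> w2 = \<zero>\<^bsub>L\<^esub>"
          using less.hyps[of h'] \<open>set h' \<subseteq> G\<close> by (simp add: h'2)
        \<comment> \<open>\<open>c2\<close> is non-zero by \<open>c0\<close>, so it can be cancelled
          in the domain \<open>L\<close>.\<close>
        then show ?thesis
          using c0 carr' L.integral by (auto simp: c12 w)
      qed
    qed
  qed
  define G' where "G' = U.simple_extension G z"
  have incl: "G \<subseteq> G'" "z \<in> G'"
    unfolding G'_def using U.simple_extension_incl[OF GU z] U.simple_extension_mem[OF subG z] by auto
  have "partial_lift G'"
    unfolding partial_lift_def
  proof (intro conjI)
    show "subring G' U"
      unfolding G'_def by (rule U.simple_extension_subring[OF subG z])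
    show "\<forall>r\<in>R. (r, j r) \<in> G'"
      using G incl by (auto simp: partial_lift_def)
    show "\<forall>(s, t)\<in>G'. s \<in> \<qq> \<longrightarrow> t = \<zero>\<^bsub>L\<^esub>"
    proof clarify
      fix s t assume st: "(s, t) \<in> G'" "s \<in> \<qq>"
      then obtain p where "polynomial\<^bsub>U\<^esub> G p" "(s, t) = U.eval p z"
        by (auto simp: G'_def U.simple_extension_as_eval_img[OF GU z] univ_poly_carrier[symmetric])
      then show "t = \<zero>\<^bsub>L\<^esub>"
        using vanish[of p] st(2) U.polynomial_incl by (metis fst_conv snd_conv)
    qed
  qed
  then show ?thesis
    using that incl by (simp add: z_def)
qed

section \<open>Zorn's lemma and the resulting homomorphism\<close>

lemma partial_lift_graph: "partial_lift ((\<lambda>r. (r, j r)) ` R)"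
  unfolding partial_lift_def
proof (intro conjI)
  interpret R: ring "S\<lparr>carrier := R\<rparr>"
    by (rule S.subring_is_ring[OF R])
  interpret j: ring_hom_ring "S\<lparr>carrier := R\<rparr>" L j
    by (rule ring_hom_ringI2) (unfold_locales, rule j_hom)
  have hom: "(\<lambda>r. (r, j r)) \<in> ring_hom (S\<lparr>carrier := R\<rparr>) U"
    using R_carrier j.hom_closed j.hom_mult j.hom_add j.hom_one
    by (intro ring_hom_memI) (auto simp: RDirProd_carrier RDirProd_simps)
  interpret graph: ring_hom_ring "S\<lparr>carrier := R\<rparr>" U "\<lambda>r. (r, j r)"
    by (rule ring_hom_ringI2) (unfold_locales, rule hom)
  show "subring ((\<lambda>r. (r, j r)) ` R) U"
    using graph.img_is_subring[OF R.carrier_is_subring] by simp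
  show "\<forall>(s, y)\<in>(\<lambda>r. (r, j r)) ` R. s \<in> \<qq> \<longrightarrow> y = \<zero>\<^bsub>L\<^esub>"
    using j_kernel by auto
qed auto

lemma partial_lift_Union:
  assumes "\<C> \<noteq> {}" and chain: "subset.chain {G. partial_lift G} \<C>"
  shows "partial_lift (\<Union>\<C>)"
proof -
  have lift: "partial_lift G" "subring G U" if "G \<in> \<C>" for G
    using that chain by (auto simp: subset.chain_def partial_lift_def)
  \<comment> \<open>Two elements of the union lie in a common member of the chain, which reduces
    closure under the binary operations to that member.\<close>
  have common: "\<exists>G\<in>\<C>. a \<in> G \<and> b \<in> G" if ab: "a \<in> \<Union>\<C>" "b \<in> \<Union>\<C>" for a b
  proof -
    obtain G H where GH: "G \<in> \<C>" "a \<in> G" "H \<in> \<C>" "b \<in> H"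
      using ab by blast
    then have "G \<subseteq> H \<or> H \<subseteq> G"
      using chain by (auto simp: subset.chain_def)
    then show ?thesis using GH by blast
  qed
  obtain G0 where "G0 \<in> \<C>"
    using assms(1) by blast
  show ?thesis
    unfolding partial_lift_def
  proof (intro conjI)
    show "subring (\<Union>\<C>) U"
    proof (rule U.subringI)
      show "\<Union>\<C> \<subseteq> carrier U"
        using lift(2) subringE(1) by blast
      show "\<one>\<^bsub>U\<^esub> \<in> \<Union>\<C>"
        using \<open>G0 \<in> \<C>\<close> lift(2) subringE(3) by blast
      show "\<ominus>\<^bsub>U\<^esub> h \<in> \<Union>\<C>" if "h \<in> \<Union>\<C>" for h
      proof -
        obtain G where "G \<in> \<C>" "h \<in> G"
          using \<open>h \<in> \<Union>\<C>\<close> by blast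
        then show ?thesis
          using subringE(5)[OF lift(2)[OF \<open>G \<in> \<C>\<close>], of h] by blast
      qed
    next
      fix a b assume "a \<in> \<Union>\<C>" "b \<in> \<Union>\<C>"
      then obtain G where "G \<in> \<C>" "a \<in> G" "b \<in> G"
        using common by blast
      then show "a \<otimes>\<^bsub>U\<^esub> b \<in> \<Union>\<C>" "a \<oplus>\<^bsub>U\<^esub> b \<in> \<Union>\<C>"
        using subringE(6,7)[OF lift(2)[OF \<open>G \<in> \<C>\<close>], of a b] \<open>G \<in> \<C>\<close> by blast+
    qed
    show "\<forall>r\<in>R. (r, j r) \<in> \<Union>\<C>"
      using \<open>G0 \<in> \<C>\<close> lift(1)[OF \<open>G0 \<in> \<C>\<close>] unfolding partial_lift_def by auto
    show "\<forall>(s, y)\<in>\<Union>\<C>. s \<in> \<qq> \<longrightarrow> y = \<zero>\<^bsub>L\<^esub>"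
    proof
      fix a assume "a \<in> \<Union>\<C>"
      then obtain G where "G \<in> \<C>" "a \<in> G"
        by blast
      then show "case a of (s, y) \<Rightarrow> s \<in> \<qq> \<longrightarrow> y = \<zero>\<^bsub>L\<^esub>"
        using lift(1)[OF \<open>G \<in> \<C>\<close>] unfolding partial_lift_def by blast
    qed
  qed
qed

theorem lift_exists:
  obtains \<psi> where "\<psi> \<in> ring_hom S L" "\<And>r. r \<in> R \<Longrightarrow> \<psi> r = j r"
    "\<And>s. s \<in> carrier S \<Longrightarrow> \<psi> s = \<zero>\<^bsub>L\<^esub> \<longleftrightarrow> s \<in> \<qq>"
proof -
  obtain M where M: "partial_lift M" and max: "\<And>G. partial_lift G \<Longrightarrow> M \<subseteq> G \<Longrightarrow> G = M"
    using subset_Zorn_nonempty[of "{G. partial_lift G}"] partial_lift_graph partial_lift_Union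
    by blast
  have sub: "subring M U"
    using M by (simp add: partial_lift_def)
  have M_carrier: "s \<in> carrier S" "y \<in> carrier L" if "(s, y) \<in> M" for s y
    using that subringE(1)[OF sub] by (auto simp: RDirProd_carrier)
  \<comment> \<open>Extending \<open>M\<close> at \<open>s\<close> yields a partial lift containing
    \<open>M\<close>, which is \<open>M\<close> itself by maximality.\<close>
  have total: "\<exists>y. (s, y) \<in> M" if "s \<in> carrier S" for s
    using partial_lift_extend[OF M that] max by metis
  have unique: "y = y'" if "(s, y) \<in> M" "(s, y') \<in> M" for s y y'
  proof -
    have "(s, y) \<oplus>\<^bsub>U\<^esub> (\<ominus>\<^bsub>U\<^esub> (s, y')) \<in> M"
      using that subringE(5,7)[OF sub] by blast
    then have "(\<zero>, y \<ominus>\<^bsub>L\<^esub> y') \<in> M"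
      using that[THEN M_carrier(1)] that[THEN M_carrier(2)]
      by (simp add: RDirProd_a_inv[OF S.ring_axioms L.ring_axioms] RDirProd_simps S.r_neg L.minus_eq)
    then have "y \<ominus>\<^bsub>L\<^esub> y' = \<zero>\<^bsub>L\<^esub>"
      using M q.zero_closed unfolding partial_lift_def by blast
    then show ?thesis
      using that[THEN M_carrier(2)] by simp
  qed
  define \<psi> where "\<psi> s = (THE y. (s, y) \<in> M)" for s
  have \<psi>_eq: "\<psi> s = y" if "(s, y) \<in> M" for s y
    unfolding \<psi>_def using that unique by blast
  have \<psi>_mem: "(s, \<psi> s) \<in> M" if "s \<in> carrier S" for s
    using total[OF that] \<psi>_eq by auto
  show ?thesis
  proof
    show "\<psi> \<in> ring_hom S L"
    proof (rule ring_hom_memI)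
      show "\<psi> \<one> = \<one>\<^bsub>L\<^esub>"
        using subringE(3)[OF sub] \<psi>_eq by (simp add: RDirProd_simps)
      show "\<psi> s \<in> carrier L" if "s \<in> carrier S" for s
        using M_carrier(2)[OF \<psi>_mem[OF that]] .
    next
      fix s t assume "s \<in> carrier S" "t \<in> carrier S"
      then have "(s, \<psi> s) \<in> M" "(t, \<psi> t) \<in> M"
        using \<psi>_mem by auto
      then show "\<psi> (s \<otimes> t) = \<psi> s \<otimes>\<^bsub>L\<^esub> \<psi> t" "\<psi> (s \<oplus> t) = \<psi> s \<oplus>\<^bsub>L\<^esub> \<psi> t"
        using subringE(6,7)[OF sub, of "(s, \<psi> s)" "(t, \<psi> t)"]
        by (auto intro!: \<psi>_eq simp: RDirProd_simps)
    qed
    show "\<psi> r = j r" if "r \<in> R" for r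
      using M that by (intro \<psi>_eq) (simp add: partial_lift_def)
    \<comment> \<open>That \<open>\<qq>\<close> lies in the kernel is part of
      \<open>partial_lift\<close>; the other inclusion is the integrality argument of
      \<open>partial_lift_reflects_zero\<close>.\<close>
    show "\<psi> s = \<zero>\<^bsub>L\<^esub> \<longleftrightarrow> s \<in> \<qq>" if "s \<in> carrier S" for s
      using \<psi>_mem[OF that] M partial_lift_reflects_zero[OF M, of s]
      by (auto simp: partial_lift_def)
  qed
qed

end

section \<open>Monic polynomials and the image of the lift\<close>

lemma monic_poly_iff:
  assumes "ring S" "\<one>\<^bsub>S\<^esub> \<noteq> \<zero>\<^bsub>S\<^esub>"
  shows "monic_poly S A p \<longleftrightarrow> p \<noteq> [] \<and> hd p = \<one>\<^bsub>S\<^esub> \<and> set p \<subseteq> A"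
proof -
  interpret ring S by fact
  show ?thesis
  proof (cases "p = []")
    case True
    then show ?thesis
      using assms(2) by (auto simp: monic_poly_def)
  next
    case False
    then show ?thesis
      using assms(2) lead_coeff_simp[OF False]
      by (auto simp: monic_poly_def univ_poly_carrier[symmetric] polynomial_def simp del: coeff.simps)
  qed
qed

text \<open>The value at \<open>y\<close> is the product of the differences of \<open>y\<close> and
  \<open>h a\<close>, and a product that vanishes in a domain has a vanishing factor.\<close>

lemma (in ring_hom_cring) eval_map_linear_factors:
  assumes "domain S" "set as \<subseteq> carrier R" "y \<in> carrier S"
    and "S.eval (map h (foldr (\<lambda>a q. [\<one>\<^bsub>R\<^esub>, \<ominus>\<^bsub>R\<^esub> a] \<otimes>\<^bsub>poly_ring R\<^esub> q) as \<one>\<^bsub>poly_ring R\<^esub>)) y = \<zero>\<^bsub>S\<^esub>"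
  shows "\<exists>a\<in>set as. y = h a"
proof -
  interpret S': domain S by fact
  let ?P = "\<lambda>as. foldr (\<lambda>a q. [\<one>\<^bsub>R\<^esub>, \<ominus>\<^bsub>R\<^esub> a] \<otimes>\<^bsub>poly_ring R\<^esub> q) as \<one>\<^bsub>poly_ring R\<^esub>"
  have P: "set (?P as) \<subseteq> carrier R" if "set as \<subseteq> carrier R" for as
    using that
  proof (induction as)
    case (Cons a as)
    then show ?case
      using R.poly_mult_in_carrier[of "[\<one>\<^bsub>R\<^esub>, \<ominus>\<^bsub>R\<^esub> a]" "?P as"]
      by (simp add: univ_poly_mult del: R.poly_mult.simps)
  qed (simp add: univ_poly_one)
  show ?thesis
    using assms(2,4)
  proof (induction as)
    case Nil
    then show ?case by (simp add: univ_poly_one)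
  next
    case (Cons a as)
    let ?e = "S.eval (map h (?P as)) y"
    have "set (map h (?P as)) \<subseteq> carrier S"
      using P[of as] Cons.prems by auto
    then have e: "?e \<in> carrier S"
      using assms(3) by (rule S.eval_in_carrier)
    have "(y \<ominus>\<^bsub>S\<^esub> h a) \<otimes>\<^bsub>S\<^esub> ?e = \<zero>\<^bsub>S\<^esub>"
      using Cons.prems eval_map_linear_mult[OF _ P assms(3), of a as]
      by (simp add: univ_poly_mult del: R.poly_mult.simps)
    then have "y \<ominus>\<^bsub>S\<^esub> h a = \<zero>\<^bsub>S\<^esub> \<or> ?e = \<zero>\<^bsub>S\<^esub>"
      using e assms(3) Cons.prems by (intro S'.integral) auto
    then show ?case
      using Cons assms(3) by auto
  qed
qed

text \<open>Monic equations over \<open>R\<close> are pushed forward by \<open>\<psi>\<close>. In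
  the other direction they are lifted and split over \<open>S\<close>, so every root in
  \<open>L\<close> is the image of one of the linear factors' roots.\<close>

lemma image_eq_integral_closure:
  assumes "cring S" "domain L" "\<psi> \<in> ring_hom S L" "subring R S" "ai_closed S"
    and int: "\<And>x. x \<in> carrier S \<Longrightarrow> integral_over S R x"
  shows "\<psi> ` carrier S = integral_closure L (\<psi> ` R)"
proof -
  interpret S: cring S by fact
  interpret L: domain L by fact
  interpret \<psi>: ring_hom_cring S L \<psi>
    by unfold_locales fact
  note R = subringE(1,3)[OF assms(4)]
  have S_one: "\<one>\<^bsub>S\<^esub> \<noteq> \<zero>\<^bsub>S\<^esub>"
    using \<psi>.hom_one \<psi>.hom_zero L.one_not_zero by metis
  note monic_S = monic_poly_iff[OF S.ring_axioms S_one]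
  note monic_L = monic_poly_iff[OF L.ring_axioms L.one_not_zero]
  show ?thesis
  proof (intro equalityI subsetI)
    fix y assume "y \<in> \<psi> ` carrier S"
    then obtain x where x: "x \<in> carrier S" "y = \<psi> x"
      by blast
    then obtain p where p: "monic_poly S R p" "S.eval p x = \<zero>\<^bsub>S\<^esub>"
      using int by (auto simp: integral_over_def)
    then have "monic_poly L (\<psi> ` R) (map \<psi> p)"
      by (auto simp: monic_S monic_L hd_map)
    moreover have "L.eval (map \<psi> p) y = \<zero>\<^bsub>L\<^esub>"
      using \<psi>.ring.eval_hom'[OF x(1), of p] p R by (auto simp: x(2) monic_S)
    ultimately show "y \<in> integral_closure L (\<psi> ` R)"
      using x by (auto simp: integral_closure_def integral_over_def)
  next
    fix y assume "y \<in> integral_closure L (\<psi> ` R)"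
    then obtain p where y: "y \<in> carrier L" "L.eval p y = \<zero>\<^bsub>L\<^esub>"
      and p: "p \<noteq> []" "hd p = \<one>\<^bsub>L\<^esub>" "set p \<subseteq> \<psi> ` R"
      by (auto simp: integral_closure_def integral_over_def monic_L)
    have "set (tl p) \<subseteq> \<psi> ` R"
      using p by (cases p) auto
    then have "tl p \<in> map \<psi> ` lists R"
      by (simp add: lists_image[symmetric] in_lists_conv_set subset_iff)
    then obtain r where r: "set r \<subseteq> R" "tl p = map \<psi> r"
      by (auto simp: in_lists_conv_set)
    \<comment> \<open>Only the lower coefficients are lifted by choice; the leading one is lifted to
      one itself, so that the lift is monic.\<close>
    have P: "map \<psi> (\<one>\<^bsub>S\<^esub> # r) = p"
      using p r by (cases p) auto
    have "monic_poly S (carrier S) (\<one>\<^bsub>S\<^esub> # r)"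
      using r R by (auto simp: monic_S)
    then obtain as where as: "set as \<subseteq> carrier S"
      "\<one>\<^bsub>S\<^esub> # r = foldr (\<lambda>a q. [\<one>\<^bsub>S\<^esub>, \<ominus>\<^bsub>S\<^esub> a] \<otimes>\<^bsub>poly_ring S\<^esub> q) as \<one>\<^bsub>poly_ring S\<^esub>"
      using assms(5) unfolding ai_closed_def by blast
    then have "\<exists>a\<in>set as. y = \<psi> a"
      using y P by (intro \<psi>.eval_map_linear_factors) (unfold_locales, auto)
    then show "y \<in> \<psi> ` carrier S"
      using as by blast
  qed
qed

section \<open>Passage to the quotients and compatibility of the algebra structures\<close>

theorem corollary2:
  fixes S :: "('a, 'b) ring_scheme" and R \<qq> :: "'a set"
    and L :: "('c, 'n) ring_scheme" and \<iota> :: "'a set \<Rightarrow> 'c"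
  assumes "aic R S"
    and "primeideal \<qq> S"
    and "alg_closure_of_fractions (contraction_quotient R S \<qq>) \<iota> L"
  shows "algebra_isomorphic (contraction_quotient R S \<qq>)
           (quotient_map S \<qq>) (S Quot \<qq>)
           \<iota> (domain_plus (contraction_quotient R S \<qq>) \<iota> L)"
proof -
  interpret q: primeideal \<qq> S by fact
  note zero_q = additive_subgroup.zero_closed[OF q.additive_subgroup_axioms]
  define D where "D = contraction_quotient R S \<qq>"
  have R: "subring R S" and ai: "ai_closed S"
    and int: "\<And>x. x \<in> carrier S \<Longrightarrow> integral_over S R x"
    using assms(1) by (auto simp: aic_def)
  have \<iota>: "\<iota> \<in> ring_hom D L" "inj_on \<iota> (carrier D)"
    and "algebraic_closure L (fractions L (\<iota> ` carrier D))"
    using assms(3) by (auto simp: alg_closure_of_fractions_def D_def)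
  then interpret L: algebraic_closure L "fractions L (\<iota> ` carrier D)"
    by simp
  have one: "\<one>\<^bsub>S\<^esub> \<noteq> \<zero>\<^bsub>S\<^esub>"
    using q.I_notcarr q.one_imp_carrier zero_q by auto
  interpret R: ring "S\<lparr>carrier := R\<rparr>"
    by (rule q.subring_is_ring[OF R])
  have "ideal (\<qq> \<inter> R) (S\<lparr>carrier := R\<rparr>)"
  proof (rule idealI[OF R.ring_axioms])
    show "subgroup (\<qq> \<inter> R) (add_monoid (S\<lparr>carrier := R\<rparr>))"
    proof (rule R.add.subgroupI)
      show "\<ominus>\<^bsub>S\<lparr>carrier := R\<rparr>\<^esub> a \<in> \<qq> \<inter> R" if "a \<in> \<qq> \<inter> R" for a
      proof -
        have "\<ominus>\<^bsub>S\<lparr>carrier := R\<rparr>\<^esub> a = \<ominus>\<^bsub>S\<^esub> a"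
          using that subringE(5)[OF R] q.Icarr[of a] by (intro R.minus_equality) (auto simp: q.l_neg)
        then show ?thesis
          using that subringE(5)[OF R] q.a_inv_closed by simp
      qed
      have "\<zero>\<^bsub>S\<^esub> \<in> \<qq> \<inter> R"
        using subringE(2)[OF R] zero_q by simp
      then show "\<qq> \<inter> R \<noteq> {}" by blast
    qed (use subringE(7)[OF R] q.a_closed in auto)
  qed (use subringE(1,6)[OF R] q.I_l_closed q.I_r_closed in auto)
  then interpret qR: ideal "\<qq> \<inter> R" "S\<lparr>carrier := R\<rparr>" .
  define c where "c r = (\<qq> \<inter> R) +>\<^bsub>S\<^esub> r" for r
  \<comment> \<open>Restricting the carrier leaves addition unchanged, so cosets formed in
    \<open>S\<close> and in the subring agree.\<close>
  have c_eq: "c = (\<lambda>r. (\<qq> \<inter> R) +>\<^bsub>S\<lparr>carrier := R\<rparr>\<^esub> r)"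
    by (simp add: c_def fun_eq_iff a_r_coset_def r_coset_def)
  have D_eq: "D = S\<lparr>carrier := R\<rparr> Quot (\<qq> \<inter> R)"
    by (simp add: D_def contraction_quotient_def)
  have c: "c \<in> ring_hom (S\<lparr>carrier := R\<rparr>) D"
    unfolding c_eq D_eq by (rule qR.rcos_ring_hom)
  have carrier_D: "carrier D = c ` R"
    by (auto simp: D_eq c_eq FactRing_def A_RCOSETS_def')
  interpret D: ring D
    unfolding D_eq by (rule qR.quotient_is_ring)
  have zero_D: "\<zero>\<^bsub>D\<^esub> = \<qq> \<inter> R"
    by (simp add: D_eq FactRing_def)
  have c_zero: "c r = \<zero>\<^bsub>D\<^esub> \<longleftrightarrow> r \<in> \<qq>" if "r \<in> R" for r
    using that qR.rcos_const_imp_mem[of r] qR.a_rcos_const[of r]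
    by (auto simp: zero_D c_eq)
  \<comment> \<open>The map \<open>j\<close> of the locale is now \<open>\<iota> \<circ> c\<close>;
    its kernel is \<qq> \<inter> R because \<open>\<iota>\<close> is injective on the
    quotient.\<close>
  have lift: "integral_lift S L \<qq> R (\<iota> \<circ> c)"
  proof (intro integral_lift.intro integral_lift_axioms.intro)
    show "\<iota> \<circ> c \<in> ring_hom (S\<lparr>carrier := R\<rparr>) L"
      by (rule ring_hom_trans[OF c \<iota>(1)])
    show "(\<iota> \<circ> c) r = \<zero>\<^bsub>L\<^esub> \<longleftrightarrow> r \<in> \<qq>" if "r \<in> R" for r
      using that c_zero[OF that] ring_hom_zero[OF \<iota>(1) D.ring_axioms L.ring_axioms]
        inj_onD[OF \<iota>(2), of "c r" "\<zero>\<^bsub>D\<^esub>"] carrier_D D.zero_closed by auto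
    show "\<exists>p. p \<noteq> [] \<and> hd p = \<one>\<^bsub>S\<^esub> \<and> set p \<subseteq> R \<and> q.eval p x = \<zero>\<^bsub>S\<^esub>" if "x \<in> carrier S" for x
      using int[OF that] by (auto simp: integral_over_def monic_poly_iff[OF q.ring_axioms one])
  qed (fact R q.cring_axioms L.algebraically_closed_axioms assms(2))+
  obtain \<psi> where \<psi>: "\<psi> \<in> ring_hom S L" "\<And>r. r \<in> R \<Longrightarrow> \<psi> r = (\<iota> \<circ> c) r"
    and ker: "\<And>s. s \<in> carrier S \<Longrightarrow> \<psi> s = \<zero>\<^bsub>L\<^esub> \<longleftrightarrow> s \<in> \<qq>"
    by (rule integral_lift.lift_exists[OF lift]) (rule that)
  have \<psi>_ring: "ring_hom_ring S L \<psi>"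
    by (rule ring_hom_ringI2[OF q.ring_axioms L.ring_axioms \<psi>(1)])
  have kernel: "a_kernel S L \<psi> = \<qq>"
    using ker q.a_subset by (auto simp: a_kernel_def')
  have image: "\<psi> ` carrier S = integral_closure L (\<iota> ` carrier D)"
  proof -
    \<comment> \<open>Every element of \<open>D\<close> is a coset \<open>c r\<close>, and
      \<open>\<psi>\<close> extends \<open>\<iota> \<circ> c\<close>.\<close>
    have "\<iota> ` carrier D = \<psi> ` R"
      using \<psi>(2) by (auto simp: carrier_D image_image)
    then show ?thesis
      using image_eq_integral_closure[OF q.cring_axioms L.domain_axioms \<psi>(1) R ai int] by simp
  qed
  \<comment> \<open>This is the map of the first isomorphism theorem: \<open>\<psi>\<close> is
    constant on cosets of its kernel \<open>\<qq>\<close>, so the image of a coset is a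
    singleton.\<close>
  define \<phi> where "\<phi> = (\<lambda>C. the_elem (\<psi> ` C))"
  have iso: "\<phi> \<in> ring_iso (S Quot \<qq>) (domain_plus D \<iota> L)"
    using ring_hom_ring.FactRing_iso_set_aux[OF \<psi>_ring] unfolding kernel image domain_plus_def \<phi>_def .
  have \<phi>: "\<phi> (\<qq> +>\<^bsub>S\<^esub> s) = \<psi> s" if "s \<in> carrier S" for s
    using ring_hom_ring.the_elem_simp[OF \<psi>_ring that] by (simp add: kernel \<phi>_def)
  have R_S: "r \<in> carrier S" if "r \<in> R" for r
    using subringE(1)[OF R] that by blast
  \<comment> \<open>The set sum of \<open>\<qq>\<close> with a coset of \<qq> \<inter> R is a single
    coset of \<open>\<qq>\<close>: elements of \<qq> \<inter> R are absorbed by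
    \<open>\<qq>\<close>, and taking zero there gives the converse.\<close>
  have map: "quotient_map S \<qq> (c r) = \<qq> +>\<^bsub>S\<^esub> r" if "r \<in> R" for r
  proof -
    have "quotient_map S \<qq> (c r) = (\<Union>a\<in>\<qq>. \<Union>b\<in>\<qq> \<inter> R. {a \<oplus>\<^bsub>S\<^esub> (b \<oplus>\<^bsub>S\<^esub> r)})"
      by (auto simp: quotient_map_def c_def set_add_def' a_r_coset_def')
    also have "\<dots> = (\<Union>a\<in>\<qq>. {a \<oplus>\<^bsub>S\<^esub> r})"
    proof (intro equalityI subsetI)
      fix t assume "t \<in> (\<Union>a\<in>\<qq>. \<Union>b\<in>\<qq> \<inter> R. {a \<oplus>\<^bsub>S\<^esub> (b \<oplus>\<^bsub>S\<^esub> r)})"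
      then obtain a b where ab: "a \<in> \<qq>" "b \<in> \<qq>" "t = a \<oplus>\<^bsub>S\<^esub> (b \<oplus>\<^bsub>S\<^esub> r)"
        by blast
      then have "t = (a \<oplus>\<^bsub>S\<^esub> b) \<oplus>\<^bsub>S\<^esub> r"
        using R_S[OF \<open>r \<in> R\<close>] q.Icarr by (simp add: q.a_assoc)
      then show "t \<in> (\<Union>a\<in>\<qq>. {a \<oplus>\<^bsub>S\<^esub> r})"
        using additive_subgroup.a_closed[OF q.additive_subgroup_axioms ab(1,2)] by blast
    next
      fix t assume "t \<in> (\<Union>a\<in>\<qq>. {a \<oplus>\<^bsub>S\<^esub> r})"
      then obtain a where a: "a \<in> \<qq>" "t = a \<oplus>\<^bsub>S\<^esub> (\<zero>\<^bsub>S\<^esub> \<oplus>\<^bsub>S\<^esub> r)"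
        using R_S[OF \<open>r \<in> R\<close>] by auto
      moreover have "\<zero>\<^bsub>S\<^esub> \<in> \<qq> \<inter> R"
        using zero_q subringE(2)[OF R] by simp
      ultimately show "t \<in> (\<Union>a\<in>\<qq>. \<Union>b\<in>\<qq> \<inter> R. {a \<oplus>\<^bsub>S\<^esub> (b \<oplus>\<^bsub>S\<^esub> r)})"
        by blast
    qed
    also have "\<dots> = \<qq> +>\<^bsub>S\<^esub> r"
      by (simp add: a_r_coset_def')
    finally show ?thesis .
  qed
  note c_mult = ring_hom_mult[OF c, simplified] and c_add = ring_hom_add[OF c, simplified]
    and c_one = ring_hom_one[OF c, simplified]
  note q_hom = q.rcos_ring_hom
  have "quotient_map S \<qq> \<in> ring_hom D (S Quot \<qq>)"
  proof (rule ring_hom_memI)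
    show "quotient_map S \<qq> d \<in> carrier (S Quot \<qq>)" if "d \<in> carrier D" for d
      using that map ring_hom_closed[OF q_hom R_S] by (auto simp: carrier_D)
    show "quotient_map S \<qq> \<one>\<^bsub>D\<^esub> = \<one>\<^bsub>S Quot \<qq>\<^esub>"
      using map[OF subringE(3)[OF R]] ring_hom_one[OF q_hom] c_one by simp
  next
    fix d e assume "d \<in> carrier D" "e \<in> carrier D"
    then obtain r s where rs: "r \<in> R" "d = c r" "s \<in> R" "e = c s"
      by (auto simp: carrier_D)
    show "quotient_map S \<qq> (d \<otimes>\<^bsub>D\<^esub> e) = quotient_map S \<qq> d \<otimes>\<^bsub>S Quot \<qq>\<^esub> quotient_map S \<qq> e"
      using rs map subringE(6)[OF R rs(1,3)] ring_hom_mult[OF q_hom, of r s] R_S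
      by (simp flip: c_mult)
    show "quotient_map S \<qq> (d \<oplus>\<^bsub>D\<^esub> e) = quotient_map S \<qq> d \<oplus>\<^bsub>S Quot \<qq>\<^esub> quotient_map S \<qq> e"
      using rs map subringE(7)[OF R rs(1,3)] ring_hom_add[OF q_hom, of r s] R_S
      by (simp flip: c_add)
  qed
  moreover have "\<iota> \<in> ring_hom D (domain_plus D \<iota> L)"
  proof (rule ring_hom_memI)
    show "\<iota> d \<in> carrier (domain_plus D \<iota> L)" if "d \<in> carrier D" for d
    proof -
      \<comment> \<open>Values of \<open>\<iota>\<close> are values of \<open>\<psi>\<close> on
        \<open>R\<close>, hence lie in the integral closure by \<open>image\<close>.\<close>
      have "\<iota> d \<in> \<psi> ` carrier S"
        using that \<psi>(2) R_S by (force simp: carrier_D)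
      then show ?thesis
        by (simp add: image domain_plus_def)
    qed
  qed (use ring_hom_mult[OF \<iota>(1)] ring_hom_add[OF \<iota>(1)] ring_hom_one[OF \<iota>(1)]
      in \<open>auto simp: domain_plus_def\<close>)
  moreover have "\<forall>d\<in>carrier D. \<phi> (quotient_map S \<qq> d) = \<iota> d"
    using map \<phi> \<psi>(2) R_S by (auto simp: carrier_D)
  ultimately show ?thesis
    using iso unfolding algebra_isomorphic_def D_def by blast
qed

end
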